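(* Let $y\in\{0,1\}$ be a binary label and $\lambda\in\mathbb{R}$ a real-valued logit with density $p(\lambda)$, jointly distributed with $y$. For bin edges $-\infty=g_0<g_1<\dots<g_{M-1}<g_M=\infty$ let $Q$ be the quantizer mapping $\lambda$ to the index $m\in\{0,\dots,M-1\}$ of the bin with $\lambda\in[g_m,g_{m+1})$. The mutual information maximization problem $$\{g_m^*\}=\arg\max_{Q:\,\{g_m\}} I(y;m=Q(\lambda))$$ is equivalent to a loss minimization problem: $$\max_{Q:\,\{g_m\}} I(y;m=Q(\lambda))\;\equiv\;\min_{\{g_m,\phi_m\}}\mathcal{L}(\{g_m,\phi_m\}),$$ where the loss is defined as $$\mathcal{L}(\{g_m,\phi_m\})=\sum_{m=0}^{M-1}\int_{g_m}^{g_{m+1}}p(\lambda)\sum_{y'\in\{0,1\}}P(y=y'\mid\lambda)\,\log\frac{P(y=y')}{\sigma\left[(2y'-1)\phi_m\right]}\,\mathrm{d}\lambda$$ and $\{\phi_m\}=\{\phi_0,\dots,\phi_{M-1}\}$ is a set of real-valued auxiliary variables.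
   Context: $M$ is the given number of bins. $\sigma(t)=1/(1+e^{-t})$ is the sigmoid function. $P(y=y'\mid\lambda)$ is the conditional probability of the label given the logit, and $P(y=y')$ is the marginal probability of the label. $I(y;m)$ is the mutual information between the discrete random variables $y$ and $m=Q(\lambda)$, where $P(m)=\int_{g_m}^{g_{m+1}}p(\lambda)\,\mathrm{d}\lambda$ and $P(m\mid y)=\int_{g_m}^{g_{m+1}}p(\lambda\mid y)\,\mathrm{d}\lambda$. The maximization is over the bin edges $\{g_m\}$ only; the minimization is jointly over the bin edges $\{g_m\}$ and the auxiliary variables $\{\phi_m\}$. The symbol $\equiv$ denotes equivalence of the two optimization problems.
   Formalization: The minimum over real φ_m is not attained if an optimal bin of positive probability has a deterministic label, so the loss minimum is read as an infimum; edges of attained joint minimizers are exactly the maximizers of I without such bins. *)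

theory Defs
  imports "HOL-Probability.Probability"
begin

definition sigmoid :: "real \<Rightarrow> real" where
  "sigmoid t = 1 / (1 + exp (- t))"

(* Edges are functions on nat of which only the values at 0, ..., M matter.
   Strictness forces the interior edges g 1, ..., g (M - 1) to be finite. *)
definition bin_edges :: "nat \<Rightarrow> (nat \<Rightarrow> ereal) \<Rightarrow> bool" where
  "bin_edges M g \<longleftrightarrow> g 0 = -\<infinity> \<and> g M = \<infinity> \<and> (\<forall>m<M. g m < g (Suc m))"

definition quantizer :: "nat \<Rightarrow> (nat \<Rightarrow> ereal) \<Rightarrow> real \<Rightarrow> nat" where
  "quantizer M g x = (THE m. m < M \<and> g m \<le> ereal x \<and> ereal x < g (Suc m))"

(* c y' is a version of the function l \<mapsto> P(y = y' | lambda = l): composed with the logit it is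
   the conditional expectation of the indicator of {Y = y'} given the sigma-algebra generated
   by the logit. It is determined only up to null sets of the law of the logit. *)
definition label_posterior ::
  "'a measure \<Rightarrow> ('a \<Rightarrow> nat) \<Rightarrow> ('a \<Rightarrow> real) \<Rightarrow> (nat \<Rightarrow> real \<Rightarrow> real) \<Rightarrow> bool" where
  "label_posterior \<Omega> Y \<Lambda> c \<longleftrightarrow>
     (\<forall>y'\<in>{0, 1}. c y' \<in> borel_measurable borel \<and>
        (AE \<omega> in \<Omega>. c y' (\<Lambda> \<omega>) =
           real_cond_exp \<Omega> (vimage_algebra (space \<Omega>) \<Lambda> borel)
             (indicator {\<omega> \<in> space \<Omega>. Y \<omega> = y'}) \<omega>))"

definition bin_information ::
  "'a measure \<Rightarrow> real \<Rightarrow> ('a \<Rightarrow> nat) \<Rightarrow> ('a \<Rightarrow> real) \<Rightarrow> nat \<Rightarrow> (nat \<Rightarrow> ereal) \<Rightarrow> real" where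
  "bin_information \<Omega> b Y \<Lambda> M g =
     prob_space.mutual_information \<Omega> b (count_space {0, 1}) (count_space {..<M})
       Y (\<lambda>\<omega>. quantizer M g (\<Lambda> \<omega>))"

(* The interval integral is over the open bin, which differs from [g m, g (m + 1)) by a
   Lebesgue null set. If P(y = y') = 0 then log b 0 = 0, and c y' vanishes almost surely. *)
definition quantization_loss ::
  "'a measure \<Rightarrow> real \<Rightarrow> ('a \<Rightarrow> nat) \<Rightarrow> (real \<Rightarrow> real) \<Rightarrow> (nat \<Rightarrow> real \<Rightarrow> real) \<Rightarrow> nat \<Rightarrow>
     (nat \<Rightarrow> ereal) \<Rightarrow> (nat \<Rightarrow> real) \<Rightarrow> real" where
  "quantization_loss \<Omega> b Y p c M g \<phi> =
     (\<Sum>m<M. LBINT x=g m..g (Suc m).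
        p x * (\<Sum>y'\<in>{0, 1}. c y' x *
          log b (\<P>(\<omega> in \<Omega>. Y \<omega> = y') / sigmoid ((2 * real y' - 1) * \<phi> m))))"

end

theory Submission
  imports Defs
begin

text \<open>
  Let \<open>q y m\<close> be the joint distribution of the label and the bin. Integrating the posterior over
  a bin turns the loss into the cross entropy
  \<open>\<Sum>m. \<Sum>y. q y m * log b (P y / sigmoid ((2 y - 1) * \<phi> m))\<close>, so that information plus loss is a
  sum over the bins of Kullback--Leibler divergences between the label distribution in the bin
  and the Bernoulli distribution with parameter \<open>sigmoid (\<phi> m)\<close>. By Gibbs' inequality each term
  is nonnegative. Its infimum over \<open>\<phi> m\<close> is zero, attained at the log-odds, which are finite
  exactly if the label is not deterministic in the bin. Hence minimizing out \<open>\<phi>\<close> leaves minus the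
  mutual information.
\<close>

subsection \<open>Divergence from a sigmoid Bernoulli distribution\<close>

lemma sigmoid_pos: "0 < sigmoid t"
  unfolding sigmoid_def by (simp add: add_pos_pos)

lemma sigmoid_minus: "sigmoid (- t) = 1 - sigmoid t"
proof -
  have "1 + exp t \<noteq> 0" "1 + exp (- t) \<noteq> 0"
    using exp_gt_zero[of t] exp_gt_zero[of "- t"] by linarith+
  moreover have "exp t * exp (- t) = 1"
    by (simp flip: exp_add)
  ultimately show ?thesis
    by (simp add: sigmoid_def field_simps)
qed

lemma inverse_sigmoid: "1 / sigmoid t = 1 + exp (- t)"
  by (simp add: sigmoid_def)

lemma sigmoid_ln_odds:
  assumes "0 < u" "0 < v"
  shows "sigmoid (ln (u / v)) = u / (u + v)"
proof -
  have "exp (- ln (u / v)) = v / u"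
    using assms by (simp add: exp_minus)
  then have "sigmoid (ln (u / v)) = 1 / (1 + v / u)"
    by (simp only: sigmoid_def)
  then show ?thesis
    using assms by (simp add: field_simps)
qed

text \<open>For \<open>u + v > 0\<close> this is \<open>u + v\<close> times the base
  \<open>b\<close> Kullback--Leibler divergence of Bernoulli \<open>u / (u + v)\<close> from
  Bernoulli \<open>sigmoid t\<close>. The masses stay unnormalized so that a bin of probability zero
  simply contributes 0.\<close>

definition sigmoid_divergence :: "real \<Rightarrow> real \<Rightarrow> real \<Rightarrow> real \<Rightarrow> real" where
  "sigmoid_divergence b u v t =
     u * log b (u / ((u + v) * sigmoid t)) + v * log b (v / ((u + v) * sigmoid (- t)))"

text \<open>Negating \<open>t\<close> exchanges the labels, so the case of a sure label 0 reduces to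
  that of a sure label 1.\<close>

lemma sigmoid_divergence_swap: "sigmoid_divergence b v u (- t) = sigmoid_divergence b u v t"
  by (simp add: sigmoid_divergence_def add.commute)

text \<open>One term of Gibbs' inequality: \<open>ln x \<le> x - 1\<close> at
  \<open>x = w / u\<close>, scaled by \<open>u / ln b\<close>. At \<open>u = 0\<close> the quotient
  is meaningless, but the left side is negative and the right side 0.\<close>

lemma mult_log_div_ge:
  assumes "1 < b" "0 \<le> u" "0 < w"
  shows "(u - w) / ln b \<le> u * log b (u / w)"
proof (cases "u = 0")
  case True
  then show ?thesis using assms by (simp add: divide_nonpos_pos)
next
  case False
  then have u: "0 < u" using assms by simp
  have "u * ln (w / u) \<le> u * (w / u - 1)"
    using u assms by (intro mult_left_mono ln_le_minus_one) auto
  also have "\<dots> = w - u" using u by (simp add: field_simps)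
  finally have "u - w \<le> u * ln (u / w)"
    using u assms by (simp add: ln_div algebra_simps)
  then show ?thesis
    using assms by (simp add: log_def divide_right_mono)
qed

lemma sigmoid_divergence_nonneg:
  assumes "1 < b" "0 \<le> u" "0 \<le> v"
  shows "0 \<le> sigmoid_divergence b u v t"
proof (cases "u + v = 0")
  case True
  then have "u = 0" "v = 0" using assms by auto
  then show ?thesis by (simp add: sigmoid_divergence_def)
next
  case False
  then have r: "0 < u + v" using assms by simp
  \<comment> \<open>The linear lower bounds of the two terms cancel, because
    \<open>sigmoid t\<close> and \<open>sigmoid (- t)\<close> add up to 1.\<close>
  have "0 = (u - (u + v) * sigmoid t) / ln b + (v - (u + v) * sigmoid (- t)) / ln b"
    by (simp add: sigmoid_minus flip: add_divide_distrib) (simp add: algebra_simps)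
  also have "\<dots> \<le> sigmoid_divergence b u v t"
    unfolding sigmoid_divergence_def
    using assms r sigmoid_pos by (intro add_mono mult_log_div_ge) auto
  finally show ?thesis .
qed

lemma sigmoid_divergence_ln_odds:
  assumes "0 < u" "0 < v"
  shows "sigmoid_divergence b u v (ln (u / v)) = 0"
proof -
  have "sigmoid (- ln (u / v)) = v / (u + v)"
    unfolding sigmoid_minus sigmoid_ln_odds[OF assms] using assms by (simp add: field_simps)
  then show ?thesis
    using assms unfolding sigmoid_divergence_def sigmoid_ln_odds[OF assms] by simp
qed

text \<open>The softplus form shows both sides of the degenerate case: positive at every real
  \<open>t\<close> when \<open>1 < b\<close>, yet tending to 0 as \<open>t\<close> grows.\<close>

lemma sigmoid_divergence_deterministic:
  assumes "0 < u"
  shows "sigmoid_divergence b u 0 t = u * ln (1 + exp (- t)) / ln b"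
  using assms by (simp add: sigmoid_divergence_def log_def inverse_sigmoid)

lemma sigmoid_divergence_deterministic_pos:
  assumes "1 < b" "0 < u"
  shows "0 < sigmoid_divergence b u 0 t"
  unfolding sigmoid_divergence_deterministic[OF assms(2)]
  using assms by (intro divide_pos_pos mult_pos_pos ln_gt_zero) auto

lemma sigmoid_divergence_deterministic_small:
  assumes "1 < b" "0 < u" "0 < e"
  shows "\<exists>t. sigmoid_divergence b u 0 t < e"
proof
  \<comment> \<open>Chosen so that the bound \<open>u * exp (- t) / ln b\<close>, which comes from
    \<open>ln (1 + x) < x\<close>, equals \<open>e\<close>.\<close>
  define t where "t = - ln (e * ln b / u)"
  have "exp (- t) = e * ln b / u"
    using assms by (simp add: t_def)
  moreover have "ln (1 + exp (- t)) < exp (- t)"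
    by (intro ln_add_one_self_less_self) simp
  ultimately have "u * ln (1 + exp (- t)) < u * (e * ln b / u)"
    using assms by (intro mult_strict_left_mono) auto
  then show "sigmoid_divergence b u 0 t < e"
    unfolding sigmoid_divergence_deterministic[OF assms(2)]
    using assms by (simp add: divide_less_eq)
qed

lemma sigmoid_divergence_small:
  assumes "1 < b" "0 \<le> u" "0 \<le> v" "0 < e"
  shows "\<exists>t. sigmoid_divergence b u v t < e"
proof -
  consider "u = 0" "v = 0" | "0 < u" "0 < v" | "0 < u" "v = 0" | "u = 0" "0 < v"
    using assms by fastforce
  then show ?thesis
  proof cases
    case 1
    then show ?thesis using assms by (simp add: sigmoid_divergence_def)
  next
    case 2
    then show ?thesis
      using sigmoid_divergence_ln_odds[of u v b] assms by (intro exI[of _ "ln (u / v)"]) simp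
  next
    case 3
    then show ?thesis using sigmoid_divergence_deterministic_small assms by simp
  next
    case 4
    then show ?thesis
      using sigmoid_divergence_deterministic_small[of b v e] assms
        sigmoid_divergence_swap[of b 0 v] by metis
  qed
qed

text \<open>If both masses vanish the divergence is identically 0, and if both are positive the
  log-odds are a zero. If exactly one vanishes, the log-odds would be infinite and the divergence
  stays positive.\<close>

lemma sigmoid_divergence_attained:
  assumes "1 < b" "0 \<le> u" "0 \<le> v"
  shows "(\<exists>t. sigmoid_divergence b u v t = 0) \<longleftrightarrow> u + v = 0 \<or> (0 < u \<and> 0 < v)"
proof -
  consider "u = 0" "v = 0" | "0 < u" "0 < v" | "0 < u" "v = 0" | "u = 0" "0 < v"
    using assms by fastforce
  then show ?thesis
  proof cases
    case 1
    then show ?thesis by (simp add: sigmoid_divergence_def)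
  next
    case 2
    then show ?thesis using sigmoid_divergence_ln_odds[of u v b] by auto
  next
    case 3
    then show ?thesis using sigmoid_divergence_deterministic_pos[OF assms(1), of u] by (auto simp: less_le)
  next
    case 4
    have "0 < sigmoid_divergence b u v t" for t
      using 4 sigmoid_divergence_deterministic_pos[OF assms(1), of v "- t"]
        sigmoid_divergence_swap[of b v u t] by simp
    then show ?thesis using 4 by (auto simp: less_le)
  qed
qed

subsection \<open>Minimizing out an auxiliary variable\<close>

text \<open>An abstract setting in which \<open>- I g\<close> is the infimum of \<open>L g\<close>
  over the auxiliary variable. \<open>approx\<close> allows a slack \<open>e\<close> because this
  infimum need not be attained.\<close>

context
  fixes P :: "'g \<Rightarrow> bool" and I :: "'g \<Rightarrow> real" and L :: "'g \<Rightarrow> 'p \<Rightarrow> real"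
  assumes lower: "\<And>g t. P g \<Longrightarrow> - I g \<le> L g t"
    and approx: "\<And>g e. P g \<Longrightarrow> 0 < e \<Longrightarrow> \<exists>t. L g t < - I g + e"
begin

lemma INF_partial_minimum:
  assumes "P g"
  shows "(INF t. ereal (L g t)) = ereal (- I g)"
proof (rule antisym)
  show "(INF t. ereal (L g t)) \<le> ereal (- I g)"
  proof (rule ereal_le_epsilon2)
    fix e :: real
    assume "0 < e"
    then obtain t where "L g t < - I g + e" using approx assms by blast
    then show "(INF t. ereal (L g t)) \<le> ereal (- I g) + ereal e"
      by (intro INF_lower2[of t]) auto
  qed
  show "ereal (- I g) \<le> (INF t. ereal (L g t))"
    using lower assms by (intro INF_greatest) simp
qed

text \<open>The joint infimum is an iterated one whose inner value is \<open>- I g\<close>; negation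
  then turns the outer infimum into a supremum. In \<open>ereal\<close> this covers empty and
  unbounded families too.\<close>

lemma SUP_eq_uminus_INF_joint:
  "(SUP g\<in>{g. P g}. ereal (I g)) = - (INF (g, t)\<in>{g. P g} \<times> UNIV. ereal (L g t))"
proof -
  have "(INF (g, t)\<in>{g. P g} \<times> UNIV. ereal (L g t)) = (INF g\<in>{g. P g}. INF t. ereal (L g t))"
    by (simp add: INF_pair case_prod_beta)
  also have "\<dots> = (INF g\<in>{g. P g}. - ereal (I g))"
    using INF_partial_minimum by (intro INF_cong) auto
  finally show ?thesis
    by (simp only: ereal_INF_uminus_eq ereal_uminus_uminus)
qed

lemma is_arg_max_iff_partial_minimum:
  "is_arg_max I P g \<longleftrightarrow> is_arg_min (\<lambda>g. INF t. ereal (L g t)) P g"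
  unfolding is_arg_max_def is_arg_min_def by (auto simp: INF_partial_minimum)

lemma is_arg_min_joint_iff:
  "is_arg_min (\<lambda>(g, t). L g t) (\<lambda>(g, t). P g) (g, t) \<longleftrightarrow> is_arg_max I P g \<and> L g t = - I g"
proof
  assume "is_arg_min (\<lambda>(g, t). L g t) (\<lambda>(g, t). P g) (g, t)"
  then have g: "P g" and min: "\<And>g' t'. P g' \<Longrightarrow> L g t \<le> L g' t'"
    by (auto simp: is_arg_min_linorder)
  \<comment> \<open>Comparison with nearly optimal auxiliary values at \<open>g'\<close>. Taking
    \<open>g' = g\<close> pins \<open>L g t\<close> to \<open>- I g\<close>; the other
    \<open>g'\<close> then give maximality of \<open>I g\<close>.\<close>
  have *: "L g t \<le> - I g'" if "P g'" for g'
  proof (rule field_le_epsilon)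
    fix e :: real
    assume "0 < e"
    with approx that obtain t' where "L g' t' < - I g' + e" by blast
    with min[OF that, of t'] show "L g t \<le> - I g' + e" by simp
  qed
  then show "is_arg_max I P g \<and> L g t = - I g"
    using g lower[OF g, of t] by (force simp: is_arg_max_def)
next
  assume "is_arg_max I P g \<and> L g t = - I g"
  then have "P g" "L g t = - I g" and max: "\<And>g'. P g' \<Longrightarrow> I g' \<le> I g"
    by (auto simp: is_arg_max_def not_less)
  moreover have "- I g \<le> L g' t'" if "P g'" for g' t'
    using max[OF that] lower[OF that, of t'] by linarith
  ultimately show "is_arg_min (\<lambda>(g, t). L g t) (\<lambda>(g, t). P g) (g, t)"
    by (auto simp: is_arg_min_linorder)
qed

end

subsection \<open>Bins\<close>

definition bin :: "(nat \<Rightarrow> ereal) \<Rightarrow> nat \<Rightarrow> real set" where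
  "bin g m = {x. g m \<le> ereal x \<and> ereal x < g (Suc m)}"

lemma bin_borel [measurable]: "bin g m \<in> sets borel"
  unfolding bin_def by measurable

lemma bin_eq_einterval_AE: "AE x in lborel. x \<in> bin g m \<longleftrightarrow> x \<in> einterval (g m) (g (Suc m))"
\<comment> \<open>Only the left edge can separate the two sets. If it is infinite,
  \<open>real_of_ereal\<close> returns 0, and excluding that single point is harmless.\<close>
proof (rule AE_mp[OF AE_lborel_singleton[of "real_of_ereal (g m)"]], rule AE_I2, rule impI)
  fix x assume "x \<noteq> real_of_ereal (g m)"
  then have "g m \<noteq> ereal x" by auto
  then show "x \<in> bin g m \<longleftrightarrow> x \<in> einterval (g m) (g (Suc m))"
    by (auto simp: bin_def einterval_def less_le)
qed

lemma bin_edges_mono: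
  assumes "bin_edges M g" "i \<le> j" "j \<le> M"
  shows "g i \<le> g j"
  using assms(2,3)
proof (induction j rule: dec_induct)
  case (step j)
  then have "g i \<le> g j" "g j < g (Suc j)"
    using assms(1) by (auto simp: bin_edges_def)
  then show ?case by (rule order.trans[OF _ less_imp_le])
qed simp

lemma ex_bin:
  assumes "bin_edges M g"
  shows "\<exists>m<M. x \<in> bin g m"
proof -
  \<comment> \<open>The first edge above \<open>x\<close> is the right edge of its bin. It is not
    edge 0, which is minus infinity, so the bin has index \<open>k - 1\<close>.\<close>
  define k where "k = (LEAST k. ereal x < g k)"
  have M: "ereal x < g M" using assms by (simp add: bin_edges_def)
  have k: "ereal x < g k" unfolding k_def using M by (rule LeastI)
  have "k \<le> M" unfolding k_def using M by (rule Least_le)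
  have "k \<noteq> 0" using k assms by (intro notI) (simp add: bin_edges_def)
  then obtain m where m: "k = Suc m" by (cases k) auto
  have "\<not> ereal x < g m"
    using not_less_Least[of m "\<lambda>k. ereal x < g k"] m by (simp add: k_def)
  then show ?thesis
    using k \<open>k \<le> M\<close> m by (intro exI[of _ m]) (auto simp: bin_def)
qed

lemma bin_unique:
  assumes "bin_edges M g" "i < M" "j < M" "x \<in> bin g i" "x \<in> bin g j"
  shows "i = j"
proof -
  \<comment> \<open>For \<open>i' < j'\<close> the right edge of bin \<open>i'\<close> lies at or
    below the left edge of bin \<open>j'\<close>, so no point is in both.\<close>
  have "\<not> i' < j'" if "j' < M" "x \<in> bin g i'" "x \<in> bin g j'" for i' j'
    using bin_edges_mono[OF assms(1), of "Suc i'" j'] that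
    by (auto simp: bin_def dest: order.strict_trans1 order.strict_trans2)
  then show ?thesis using assms by (metis linorder_neqE_nat)
qed

text \<open>Existence and uniqueness of the bin make the definite description in
  \<open>quantizer\<close> well defined.\<close>

lemma quantizer_eq_iff:
  assumes "bin_edges M g" "m < M"
  shows "quantizer M g x = m \<longleftrightarrow> x \<in> bin g m"
proof -
  obtain k where k: "k < M" "x \<in> bin g k" using ex_bin[OF assms(1)] by blast
  have "quantizer M g x = k"
    unfolding quantizer_def using k bin_unique[OF assms(1)]
    by (intro the_equality) (auto simp: bin_def)
  then show ?thesis using k bin_unique[OF assms(1) _ assms(2)] by auto
qed

lemma quantizer_less:
  assumes "bin_edges M g"
  shows "quantizer M g x < M"
  using ex_bin[OF assms, of x] quantizer_eq_iff[OF assms] by metis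

lemma quantizer_measurable:
  assumes "bin_edges M g"
  shows "quantizer M g \<in> measurable borel (count_space {..<M})"
proof (rule measurable_count_space_eq2[THEN iffD2], simp, intro conjI ballI)
  show "quantizer M g \<in> space borel \<rightarrow> {..<M}"
    using quantizer_less[OF assms] by auto
  fix m assume "m \<in> {..<M}"
  then have "quantizer M g -` {m} \<inter> space borel = bin g m"
    using quantizer_eq_iff[OF assms] by auto
  then show "quantizer M g -` {m} \<inter> space borel \<in> sets borel" by simp
qed

subsection \<open>Mutual information of finitely valued random variables\<close>

text \<open>The probability mass function is a density with respect to counting measure on all of
  \<open>A\<close>; values of \<open>A\<close> that \<open>X\<close> never takes just have mass
  0.\<close>

lemma (in prob_space) distributed_finite:
  assumes "finite A" and X: "X \<in> measurable M (count_space A)"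
  shows "distributed M (count_space A) X (\<lambda>a. ennreal (\<P>(\<omega> in M. X \<omega> = a)))"
  unfolding distributed_def
proof (intro conjI measure_eqI_finite[of _ A] X assms(1))
  fix a assume a: "a \<in> A"
  have "X -` {a} \<inter> space M = {\<omega> \<in> space M. X \<omega> = a}" by auto
  then show "emeasure (distr M (count_space A) X) {a} =
      emeasure (density (count_space A) (\<lambda>a. ennreal (\<P>(\<omega> in M. X \<omega> = a)))) {a}"
    using a assms(1) X
    by (simp add: emeasure_distr emeasure_density nn_integral_count_space_finite
        emeasure_eq_measure indicator_def if_distrib[of "times _"] sum.delta cong: if_cong)
qed auto

text \<open>On finite sets the product of counting measures is again a counting measure, so all
  densities are mass functions. The second variable is summed outermost to match the sum over bins
  in the loss.\<close>

lemma (in information_space) mutual_information_finite: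
  assumes A: "finite A" and X: "X \<in> measurable M (count_space A)"
    and B: "finite B" and Y: "Y \<in> measurable M (count_space B)"
  shows "mutual_information b (count_space A) (count_space B) X Y =
    (\<Sum>y\<in>B. \<Sum>x\<in>A. \<P>(\<omega> in M. X \<omega> = x \<and> Y \<omega> = y) *
      log b (\<P>(\<omega> in M. X \<omega> = x \<and> Y \<omega> = y) / (\<P>(\<omega> in M. X \<omega> = x) * \<P>(\<omega> in M. Y \<omega> = y))))"
proof -
  have XY: "(\<lambda>\<omega>. (X \<omega>, Y \<omega>)) \<in> measurable M (count_space (A \<times> B))"
    using measurable_Pair[OF X Y] by (simp add: pair_measure_count_space A B)
  have "distributed M (count_space A \<Otimes>\<^sub>M count_space B) (\<lambda>\<omega>. (X \<omega>, Y \<omega>))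
      (\<lambda>z. ennreal (\<P>(\<omega> in M. (X \<omega>, Y \<omega>) = z)))"
    using distributed_finite[OF _ XY] A B by (simp add: pair_measure_count_space)
  from mutual_information_distr[OF _ _ distributed_finite[OF A X] _ distributed_finite[OF B Y] _ this]
  show ?thesis
    using A B
    by (simp add: sigma_finite_measure_count_space_finite pair_measure_count_space
        lebesgue_integral_count_space_finite sum.cartesian_product' case_prod_beta)
       (subst sum.swap, simp)
qed

subsection \<open>The loss as a cross entropy\<close>

text \<open>The defining property of conditional expectation, tested against the indicator that the
  logit lies in the bin, which is measurable for the sigma-algebra generated by the logit. The
  density \<open>p\<close> carries the integral to the real line.\<close>

lemma (in prob_space) bin_joint_probability:
  assumes [measurable]: "Y \<in> measurable M (count_space {0, 1})"
    and p: "\<And>x. 0 \<le> p x"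
    and D: "distributed M lborel \<Lambda> (\<lambda>x. ennreal (p x))"
    and c: "label_posterior M Y \<Lambda> c"
    and y: "y \<in> {0, 1}"
  shows "set_integrable lborel (einterval (g m) (g (Suc m))) (\<lambda>x. p x * c y x)" (is ?integrable)
    and "(LINT x:einterval (g m) (g (Suc m))|lborel. p x * c y x) =
      \<P>(\<omega> in M. Y \<omega> = y \<and> \<Lambda> \<omega> \<in> bin g m)" (is ?integral)
proof -
  define F where "F = vimage_algebra (space M) \<Lambda> borel"
  have \<Lambda>[measurable]: "\<Lambda> \<in> borel_measurable M"
    using distributed_measurable[OF D] by simp
  have p_meas[measurable]: "p \<in> borel_measurable borel"
    using distributed_real_measurable[OF _ D] p by simp
  have c_meas[measurable]: "c y \<in> borel_measurable borel"
    and c_eq: "AE \<omega> in M. c y (\<Lambda> \<omega>) = real_cond_exp M F (indicator {\<omega> \<in> space M. Y \<omega> = y}) \<omega>"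
    using c y by (auto simp: label_posterior_def F_def)
  have F: "\<Lambda> \<in> measurable F borel"
    unfolding F_def by (rule measurable_vimage_algebra1) simp
  have "subalgebra M F"
    unfolding subalgebra_def F_def
    using measurable_sets[OF \<Lambda>] by (auto simp: sets_vimage_algebra2)
  then interpret F: finite_measure_subalgebra M F
    by unfold_locales
  have Y_event[measurable]: "{\<omega> \<in> space M. Y \<omega> = y} \<in> sets M"
    using y by measurable
  let ?f = "\<lambda>\<omega>. indicator (bin g m) (\<Lambda> \<omega>) :: real"
  let ?Y = "indicator {\<omega> \<in> space M. Y \<omega> = y} :: 'a \<Rightarrow> real"
  have f: "?f \<in> borel_measurable F"
    using F by measurable
  have prod: "?f \<omega> * ?Y \<omega> = indicator {\<omega> \<in> space M. Y \<omega> = y \<and> \<Lambda> \<omega> \<in> bin g m} \<omega>"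
    if "\<omega> \<in> space M" for \<omega>
    using that by (auto simp: indicator_def)
  have joint[measurable]: "{\<omega> \<in> space M. Y \<omega> = y \<and> \<Lambda> \<omega> \<in> bin g m} \<in> sets M"
    using y by measurable
  have int: "integrable M (\<lambda>\<omega>. ?f \<omega> * ?Y \<omega>)"
    by (subst Bochner_Integration.integrable_cong[OF refl prod])
      (auto simp: emeasure_eq_measure)
  \<comment> \<open>The posterior is only a version of the conditional expectation, so the two are
    exchanged almost everywhere.\<close>
  have ae: "AE \<omega> in M. indicator (bin g m) (\<Lambda> \<omega>) * c y (\<Lambda> \<omega>) = ?f \<omega> * real_cond_exp M F ?Y \<omega>"
    using c_eq by eventually_elim simp
  have rc: "(\<lambda>\<omega>. ?f \<omega> * real_cond_exp M F ?Y \<omega>) \<in> borel_measurable M"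
    using F.real_cond_exp_intg(1)[OF int f] by auto
  have int': "integrable M (\<lambda>\<omega>. indicator (bin g m) (\<Lambda> \<omega>) * c y (\<Lambda> \<omega>))"
    using F.real_cond_exp_intg(1)[OF int f]
    by (subst integrable_cong_AE[OF _ rc ae]) auto
  have intp: "integrable lborel (\<lambda>x. p x * (indicator (bin g m) x * c y x))"
    using int' by (subst distributed_integrable[OF D]) (auto simp: p)
  \<comment> \<open>The loss integrates over the open interval, the probability concerns the
    half-open bin; they agree up to a Lebesgue null set.\<close>
  have ae': "AE x in lborel. indicator (einterval (g m) (g (Suc m))) x *\<^sub>R (p x * c y x) =
      p x * (indicator (bin g m) x * c y x)"
    using bin_eq_einterval_AE[of g m] by eventually_elim (auto simp: indicator_def)
  show ?integrable
    unfolding set_integrable_def using intp by (subst integrable_cong_AE[OF _ _ ae']) auto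
  have "(LINT x:einterval (g m) (g (Suc m))|lborel. p x * c y x) =
      (\<integral>x. p x * (indicator (bin g m) x * c y x) \<partial>lborel)"
    unfolding set_lebesgue_integral_def by (intro integral_cong_AE ae') auto
  also have "\<dots> = (\<integral>\<omega>. indicator (bin g m) (\<Lambda> \<omega>) * c y (\<Lambda> \<omega>) \<partial>M)"
    by (rule distributed_integral[OF D]) (auto simp: p)
  also have "\<dots> = (\<integral>\<omega>. ?f \<omega> * real_cond_exp M F ?Y \<omega> \<partial>M)"
    by (intro integral_cong_AE ae rc) auto
  also have "\<dots> = (\<integral>\<omega>. ?f \<omega> * ?Y \<omega> \<partial>M)"
    by (rule F.real_cond_exp_intg(2)[OF int f]) auto
  also have "\<dots> = (\<integral>\<omega>. indicator {\<omega> \<in> space M. Y \<omega> = y \<and> \<Lambda> \<omega> \<in> bin g m} \<omega> \<partial>M)"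
    by (rule Bochner_Integration.integral_cong[OF refl prod])
  also have "\<dots> = \<P>(\<omega> in M. Y \<omega> = y \<and> \<Lambda> \<omega> \<in> bin g m)"
    by simp
  finally show ?integral .
qed

lemma (in prob_space) quantization_loss_eq_cross_entropy:
  assumes Y: "Y \<in> measurable M (count_space {0, 1})"
    and p: "\<And>x. 0 \<le> p x"
    and D: "distributed M lborel \<Lambda> (\<lambda>x. ennreal (p x))"
    and c: "label_posterior M Y \<Lambda> c"
    and g: "bin_edges N g"
  shows "quantization_loss M b Y p c N g \<phi> =
    (\<Sum>m<N. \<Sum>y\<in>{0, 1}. \<P>(\<omega> in M. Y \<omega> = y \<and> quantizer N g (\<Lambda> \<omega>) = m) *
      log b (\<P>(\<omega> in M. Y \<omega> = y) / sigmoid ((2 * real y - 1) * \<phi> m)))"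
  unfolding quantization_loss_def
proof (rule sum.cong[OF refl])
  fix m assume "m \<in> {..<N}"
  then have m: "m < N" and le: "g m \<le> g (Suc m)"
    using g by (auto simp: bin_edges_def less_imp_le)
  note joint = bin_joint_probability[OF Y p D c, of _ g m]
  \<comment> \<open>Within a bin the logarithm depends on the label only, so it is a constant factor
    of the integral.\<close>
  define K where "K = (\<lambda>y. log b (\<P>(\<omega> in M. Y \<omega> = y) / sigmoid ((2 * real y - 1) * \<phi> m)))"
  let ?E = "einterval (g m) (g (Suc m))"
  \<comment> \<open>\<open>le\<close> fixes the orientation of the interval integral, which would
    otherwise change sign.\<close>
  have "(LBINT x=g m..g (Suc m). p x * (\<Sum>y\<in>{0, 1}. c y x * K y)) =
      (LINT x:?E|lborel. p x * c 0 x * K 0 + p x * c 1 x * K 1)"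
    using le by (simp add: interval_lebesgue_integral_def algebra_simps)
  also have "\<dots> = (LINT x:?E|lborel. p x * c 0 x * K 0) + (LINT x:?E|lborel. p x * c 1 x * K 1)"
    using joint(1)[of 0] joint(1)[of 1] by (intro set_integral_add set_integrable_mult_left) auto
  also have "\<dots> = (\<Sum>y\<in>{0, 1}. \<P>(\<omega> in M. Y \<omega> = y \<and> quantizer N g (\<Lambda> \<omega>) = m) * K y)"
    using joint(2)[of 0] joint(2)[of 1] by (simp add: quantizer_eq_iff[OF g m])
  finally show "(LBINT x=g m..g (Suc m). p x * (\<Sum>y\<in>{0, 1}. c y x *
        log b (\<P>(\<omega> in M. Y \<omega> = y) / sigmoid ((2 * real y - 1) * \<phi> m)))) =
      (\<Sum>y\<in>{0, 1}. \<P>(\<omega> in M. Y \<omega> = y \<and> quantizer N g (\<Lambda> \<omega>) = m) *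
        log b (\<P>(\<omega> in M. Y \<omega> = y) / sigmoid ((2 * real y - 1) * \<phi> m)))"
    unfolding K_def .
qed

section \<open>Information plus loss as a sum of divergences\<close>

lemma log_information_plus_log_loss:
  assumes "0 \<le> q" "q \<le> \<pi>" "q \<le> r" "0 < s"
  shows "q * log b (q / (\<pi> * r)) + q * log b (\<pi> / s) = q * log b (q / (r * s))"
proof (cases "q = 0")
  case False
  \<comment> \<open>A positive joint probability forces positive marginals, so the logarithms split
    and \<open>\<pi>\<close> cancels. For \<open>q = 0\<close> every term vanishes.\<close>
  then have "0 < q" "0 < \<pi>" "0 < r" using assms by auto
  then show ?thesis
    using assms by (simp add: log_divide log_mult algebra_simps)
qed simp

text \<open>The label marginal cancels bin by bin. The second part splits the bin probability by
  label, which supplies the normalization \<open>u + v\<close> in the divergence.\<close>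

lemma (in information_space) information_plus_loss:
  assumes Y[measurable]: "Y \<in> measurable M (count_space {0, 1})"
    and p: "\<And>x. 0 \<le> p x"
    and D: "distributed M lborel \<Lambda> (\<lambda>x. ennreal (p x))"
    and c: "label_posterior M Y \<Lambda> c"
    and g: "bin_edges N g"
  shows "bin_information M b Y \<Lambda> N g + quantization_loss M b Y p c N g \<phi> =
    (\<Sum>m<N. sigmoid_divergence b
      (\<P>(\<omega> in M. Y \<omega> = 1 \<and> quantizer N g (\<Lambda> \<omega>) = m))
      (\<P>(\<omega> in M. Y \<omega> = 0 \<and> quantizer N g (\<Lambda> \<omega>) = m)) (\<phi> m))"
    and "m < N \<Longrightarrow> \<P>(\<omega> in M. quantizer N g (\<Lambda> \<omega>) = m) =
      \<P>(\<omega> in M. Y \<omega> = 1 \<and> quantizer N g (\<Lambda> \<omega>) = m) +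
      \<P>(\<omega> in M. Y \<omega> = 0 \<and> quantizer N g (\<Lambda> \<omega>) = m)"
proof -
  have "\<Lambda> \<in> borel_measurable M"
    using distributed_measurable[OF D] by simp
  then have Q[measurable]: "(\<lambda>\<omega>. quantizer N g (\<Lambda> \<omega>)) \<in> measurable M (count_space {..<N})"
    using quantizer_measurable[OF g] by measurable
  define q where "q = (\<lambda>y m. \<P>(\<omega> in M. Y \<omega> = y \<and> quantizer N g (\<Lambda> \<omega>) = m))"
  define r where "r = (\<lambda>m. \<P>(\<omega> in M. quantizer N g (\<Lambda> \<omega>) = m))"
  define \<pi> where "\<pi> = (\<lambda>y. \<P>(\<omega> in M. Y \<omega> = y))"
  have Y01: "Y \<omega> = 0 \<or> Y \<omega> = 1" if "\<omega> \<in> space M" for \<omega>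
    using measurable_space[OF Y that] by auto
  have sets: "{\<omega> \<in> space M. Y \<omega> = y} \<in> sets M" "{\<omega> \<in> space M. quantizer N g (\<Lambda> \<omega>) = m} \<in> sets M"
      "{\<omega> \<in> space M. Y \<omega> = y \<and> quantizer N g (\<Lambda> \<omega>) = m} \<in> sets M"
    if "y \<in> {0, 1}" "m < N" for y m
  proof -
    have "Y -` {y} \<inter> space M \<in> sets M" "(\<lambda>\<omega>. quantizer N g (\<Lambda> \<omega>)) -` {m} \<inter> space M \<in> sets M"
      using that by (auto intro: measurable_sets[OF Y] measurable_sets[OF Q])
    moreover have "Y -` {y} \<inter> space M = {\<omega> \<in> space M. Y \<omega> = y}"
        "(\<lambda>\<omega>. quantizer N g (\<Lambda> \<omega>)) -` {m} \<inter> space M = {\<omega> \<in> space M. quantizer N g (\<Lambda> \<omega>) = m}"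
      by auto
    ultimately show "{\<omega> \<in> space M. Y \<omega> = y} \<in> sets M"
        "{\<omega> \<in> space M. quantizer N g (\<Lambda> \<omega>) = m} \<in> sets M"
      by simp_all
    then show "{\<omega> \<in> space M. Y \<omega> = y \<and> quantizer N g (\<Lambda> \<omega>) = m} \<in> sets M"
      by (intro sets.sets_Collect_conj)
  qed
  have r: "r m = q 1 m + q 0 m" if "m < N" for m
  proof -
    have "{\<omega> \<in> space M. quantizer N g (\<Lambda> \<omega>) = m} =
        {\<omega> \<in> space M. Y \<omega> = 1 \<and> quantizer N g (\<Lambda> \<omega>) = m} \<union>
        {\<omega> \<in> space M. Y \<omega> = 0 \<and> quantizer N g (\<Lambda> \<omega>) = m}"
      using Y01 by blast
    then show ?thesis
      unfolding r_def q_def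
      using sets(3)[OF _ that, of 0] sets(3)[OF _ that, of 1] by (auto intro!: finite_measure_Union)
  qed
  then show "m < N \<Longrightarrow> \<P>(\<omega> in M. quantizer N g (\<Lambda> \<omega>) = m) =
      \<P>(\<omega> in M. Y \<omega> = 1 \<and> quantizer N g (\<Lambda> \<omega>) = m) +
      \<P>(\<omega> in M. Y \<omega> = 0 \<and> quantizer N g (\<Lambda> \<omega>) = m)"
    by (simp add: q_def r_def)
  have bound: "0 \<le> q y m" "q y m \<le> \<pi> y" "q y m \<le> r m" if "y \<in> {0, 1}" "m < N" for y m
    unfolding q_def \<pi>_def r_def using sets[OF that] by (auto intro!: finite_measure_mono)
  have information: "bin_information M b Y \<Lambda> N g =
      (\<Sum>m<N. \<Sum>y\<in>{0, 1}. q y m * log b (q y m / (\<pi> y * r m)))"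
    unfolding bin_information_def q_def \<pi>_def r_def
    by (rule mutual_information_finite[OF _ Y _ Q]) auto
  have "bin_information M b Y \<Lambda> N g + quantization_loss M b Y p c N g \<phi> =
      (\<Sum>m<N. \<Sum>y\<in>{0, 1}. q y m * log b (q y m / (\<pi> y * r m)) +
        q y m * log b (\<pi> y / sigmoid ((2 * real y - 1) * \<phi> m)))"
    unfolding information quantization_loss_eq_cross_entropy[OF Y p D c g] sum.distrib
    by (simp only: q_def \<pi>_def)
  also have "\<dots> = (\<Sum>m<N. \<Sum>y\<in>{0, 1}. q y m * log b (q y m / (r m * sigmoid ((2 * real y - 1) * \<phi> m))))"
    using bound sigmoid_pos by (intro sum.cong refl log_information_plus_log_loss) auto
  \<comment> \<open>The factor \<open>2 * real y - 1\<close> is 1 for label 1 and -1 for label 0,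
    giving the terms with \<open>sigmoid (\<phi> m)\<close> and
    \<open>sigmoid (- \<phi> m)\<close>.\<close>
  also have "\<dots> = (\<Sum>m<N. sigmoid_divergence b (q 1 m) (q 0 m) (\<phi> m))"
    by (intro sum.cong refl) (simp add: sigmoid_divergence_def r)
  finally show "bin_information M b Y \<Lambda> N g + quantization_loss M b Y p c N g \<phi> =
      (\<Sum>m<N. sigmoid_divergence b
        (\<P>(\<omega> in M. Y \<omega> = 1 \<and> quantizer N g (\<Lambda> \<omega>) = m))
        (\<P>(\<omega> in M. Y \<omega> = 0 \<and> quantizer N g (\<Lambda> \<omega>) = m)) (\<phi> m))"
    by (simp add: q_def)
qed

section \<open>Infimum and attainment of the divergence summed over bins\<close>

lemma sum_sigmoid_divergence_small:
  fixes N :: nat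
  assumes "1 < b" "\<And>m. 0 \<le> u m" "\<And>m. 0 \<le> v m" "0 < e"
  shows "\<exists>\<phi>. (\<Sum>m<N. sigmoid_divergence b (u m) (v m) (\<phi> m)) < e"
proof (cases "N = 0")
  case True
  then show ?thesis using assms by simp
next
  case False
  \<comment> \<open>The slack is shared equally among the bins, whose auxiliary variables are chosen
    independently.\<close>
  then have "\<exists>t. sigmoid_divergence b (u m) (v m) t < e / real N" for m
    using assms by (intro sigmoid_divergence_small) auto
  then obtain \<phi> where "\<And>m. sigmoid_divergence b (u m) (v m) (\<phi> m) < e / real N"
    by metis
  then have "(\<Sum>m<N. sigmoid_divergence b (u m) (v m) (\<phi> m)) < (\<Sum>m<N. e / real N)"
    using False by (intro sum_strict_mono) auto
  then show ?thesis using False by auto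
qed

text \<open>A sum of nonnegative terms vanishes only if each term does, and independent coordinates
  of \<open>\<phi>\<close> let the existential quantifier move inside the one over bins.\<close>

lemma sum_sigmoid_divergence_attained:
  fixes N :: nat
  assumes "1 < b" "\<And>m. 0 \<le> u m" "\<And>m. 0 \<le> v m"
  shows "(\<exists>\<phi>. (\<Sum>m<N. sigmoid_divergence b (u m) (v m) (\<phi> m)) = 0) \<longleftrightarrow>
    (\<forall>m<N. u m + v m = 0 \<or> 0 < u m \<and> 0 < v m)"
proof -
  have "(\<exists>\<phi>. (\<Sum>m<N. sigmoid_divergence b (u m) (v m) (\<phi> m)) = 0) \<longleftrightarrow>
      (\<exists>\<phi>. \<forall>m<N. sigmoid_divergence b (u m) (v m) (\<phi> m) = 0)"
    using sigmoid_divergence_nonneg assms by (subst sum_nonneg_eq_0_iff) auto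
  also have "\<dots> \<longleftrightarrow> (\<forall>m<N. \<exists>t. sigmoid_divergence b (u m) (v m) t = 0)"
    by metis
  finally show ?thesis
    using sigmoid_divergence_attained assms by simp
qed

theorem theorem1:
  fixes \<Omega> :: "'a measure" and Y :: "'a \<Rightarrow> nat" and \<Lambda> :: "'a \<Rightarrow> real"
    and p :: "real \<Rightarrow> real" and c :: "nat \<Rightarrow> real \<Rightarrow> real" and b :: real and M :: nat
  assumes "prob_space \<Omega>"
    and "Y \<in> measurable \<Omega> (count_space {0, 1})"
    and "\<And>x. 0 \<le> p x"
    and "distributed \<Omega> lborel \<Lambda> (\<lambda>x. ennreal (p x))"
    and "label_posterior \<Omega> Y \<Lambda> c"
    and "b > 1"
    and "M \<ge> 1"
  defines "I \<equiv> bin_information \<Omega> b Y \<Lambda> M"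
    and "L \<equiv> quantization_loss \<Omega> b Y p c M"
  shows
    "(SUP g\<in>{g. bin_edges M g}. ereal (I g)) =
       - (INF (g, \<phi>)\<in>{g. bin_edges M g} \<times> UNIV. ereal (L g \<phi>)) \<and>
     \<comment> \<open>same optimal bin edges, the auxiliary variables being minimized out\<close>
     (\<forall>g. is_arg_max I (bin_edges M) g \<longleftrightarrow>
           is_arg_min (\<lambda>g. INF \<phi>. ereal (L g \<phi>)) (bin_edges M) g) \<and>
     \<comment> \<open>attained joint minimizers: a minimizing real value of the auxiliary variables exists
        exactly if no bin of positive probability has a deterministic label\<close>
     (\<forall>g. (\<exists>\<phi>. is_arg_min (\<lambda>(g, \<phi>). L g \<phi>) (\<lambda>(g, \<phi>). bin_edges M g) (g, \<phi>)) \<longleftrightarrow>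
           is_arg_max I (bin_edges M) g \<and>
           (\<forall>m<M. \<P>(\<omega> in \<Omega>. quantizer M g (\<Lambda> \<omega>) = m) > 0 \<longrightarrow>
              \<P>(\<omega> in \<Omega>. Y \<omega> = 1 \<bar> quantizer M g (\<Lambda> \<omega>) = m) \<in> {0<..<1}))"
proof -
  interpret information_space \<Omega> b
    using assms(1,6) by (simp add: information_space_def information_space_axioms_def)
  define u where "u = (\<lambda>g m. \<P>(\<omega> in \<Omega>. Y \<omega> = 1 \<and> quantizer M g (\<Lambda> \<omega>) = m))"
  define v where "v = (\<lambda>g m. \<P>(\<omega> in \<Omega>. Y \<omega> = 0 \<and> quantizer M g (\<Lambda> \<omega>) = m))"
  have uv: "0 \<le> u g m" "0 \<le> v g m" for g m
    by (simp_all add: u_def v_def)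
  have IL: "L g \<phi> = - I g + (\<Sum>m<M. sigmoid_divergence b (u g m) (v g m) (\<phi> m))"
    if "bin_edges M g" for g \<phi>
    using information_plus_loss(1)[OF assms(2-5) that, of \<phi>] by (simp add: I_def L_def u_def v_def)
  have r: "\<P>(\<omega> in \<Omega>. quantizer M g (\<Lambda> \<omega>) = m) = u g m + v g m" if "bin_edges M g" "m < M" for g m
    using information_plus_loss(2)[OF assms(2-5) that] by (simp add: u_def v_def)
  have lower: "- I g \<le> L g \<phi>" if "bin_edges M g" for g \<phi>
    using IL[OF that] uv assms(6) by (simp add: sum_nonneg sigmoid_divergence_nonneg)
  have approx: "\<exists>\<phi>. L g \<phi> < - I g + e" if "bin_edges M g" "0 < e" for g e
    using IL[OF that(1)] uv assms(6) that(2)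
      sum_sigmoid_divergence_small[of b "u g" "v g" e M] by auto
  have attained: "(\<exists>\<phi>. L g \<phi> = - I g) \<longleftrightarrow>
      (\<forall>m<M. \<P>(\<omega> in \<Omega>. quantizer M g (\<Lambda> \<omega>) = m) > 0 \<longrightarrow>
        \<P>(\<omega> in \<Omega>. Y \<omega> = 1 \<bar> quantizer M g (\<Lambda> \<omega>) = m) \<in> {0<..<1})" if g: "bin_edges M g" for g
  proof -
    have "(\<exists>\<phi>. L g \<phi> = - I g) \<longleftrightarrow> (\<forall>m<M. u g m + v g m = 0 \<or> 0 < u g m \<and> 0 < v g m)"
      using IL[OF g] uv assms(6) sum_sigmoid_divergence_attained[of b "u g" "v g" M] by simp
    moreover have "(u g m + v g m = 0 \<or> 0 < u g m \<and> 0 < v g m) \<longleftrightarrow>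
        (\<P>(\<omega> in \<Omega>. quantizer M g (\<Lambda> \<omega>) = m) > 0 \<longrightarrow>
          \<P>(\<omega> in \<Omega>. Y \<omega> = 1 \<bar> quantizer M g (\<Lambda> \<omega>) = m) \<in> {0<..<1})" if "m < M" for m
    proof -
      \<comment> \<open>On a bin of positive probability this quotient lies strictly between 0 and 1
        exactly if both masses are positive. On a null bin both sides of the equivalence
        hold.\<close>
      have "\<P>(\<omega> in \<Omega>. Y \<omega> = 1 \<bar> quantizer M g (\<Lambda> \<omega>) = m) = u g m / (u g m + v g m)"
        by (simp add: cond_prob_def r[OF g that]) (simp add: u_def)
      then show ?thesis
        using uv[of g m] r[OF g that]
        by (cases "u g m + v g m = 0") (auto simp: less_le divide_less_eq zero_less_divide_iff)
    qed
    ultimately show ?thesis by simp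
  qed
  have joint: "is_arg_min (\<lambda>(g, \<phi>). L g \<phi>) (\<lambda>(g, \<phi>). bin_edges M g) (g, \<phi>) \<longleftrightarrow>
      is_arg_max I (bin_edges M) g \<and> L g \<phi> = - I g" for g \<phi>
    using lower approx by (rule is_arg_min_joint_iff)
  show ?thesis
  proof (intro conjI allI)
    show "(SUP g\<in>{g. bin_edges M g}. ereal (I g)) =
        - (INF (g, \<phi>)\<in>{g. bin_edges M g} \<times> UNIV. ereal (L g \<phi>))"
      using lower approx by (rule SUP_eq_uminus_INF_joint)
    fix g
    show "is_arg_max I (bin_edges M) g \<longleftrightarrow>
        is_arg_min (\<lambda>g. INF \<phi>. ereal (L g \<phi>)) (bin_edges M) g"
      using lower approx by (rule is_arg_max_iff_partial_minimum)
    show "(\<exists>\<phi>. is_arg_min (\<lambda>(g, \<phi>). L g \<phi>) (\<lambda>(g, \<phi>). bin_edges M g) (g, \<phi>)) \<longleftrightarrow>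
        is_arg_max I (bin_edges M) g \<and>
        (\<forall>m<M. \<P>(\<omega> in \<Omega>. quantizer M g (\<Lambda> \<omega>) = m) > 0 \<longrightarrow>
          \<P>(\<omega> in \<Omega>. Y \<omega> = 1 \<bar> quantizer M g (\<Lambda> \<omega>) = m) \<in> {0<..<1})"
    proof (cases "bin_edges M g")
      case True
      show ?thesis unfolding joint attained[OF True, symmetric] by blast
    next
      case False
      \<comment> \<open>Both sides fail for inadmissible edges, since \<open>is_arg_max\<close>
        includes feasibility.\<close>
      then show ?thesis unfolding joint is_arg_max_def by blast
    qed
  qed
qed

end
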